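(* Let $p$ be a prime. The map $\mathscr{S} : C(\mathbb{Z}_p,\mathbb{C}_p) \to C(\mathbb{Z}_p,\mathbb{C}_p)$ defined by $\mathscr{S}(\phi)(x) = \phi(x) - x\phi(x-1)$ restricts to an automorphism of the $\mathbb{C}_p$-vector space $\mathrm{la}(\mathbb{Z}_p,\mathbb{C}_p)$ of locally analytic functions $\mathbb{Z}_p \to \mathbb{C}_p$.
   Context: $C(\mathbb{Z}_p,\mathbb{C}_p)$ denotes the $\mathbb{C}_p$-vector space of continuous functions $\mathbb{Z}_p \to \mathbb{C}_p$. A function $f : \mathbb{Z}_p \to \mathbb{C}_p$ is locally analytic if every $x_0 \in \mathbb{Z}_p$ has a neighbourhood (ball) in $\mathbb{Z}_p$ on which $f$ is given by a convergent power series in $x - x_0$ with coefficients in $\mathbb{C}_p$; $\mathrm{la}(\mathbb{Z}_p,\mathbb{C}_p) \subset C(\mathbb{Z}_p,\mathbb{C}_p)$ is the subspace of such functions. *)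

theory Defs
  imports
    "HOL-Analysis.Analysis"
    "HOL-Computational_Algebra.Computational_Algebra"
    "HOL-Library.Function_Algebras"
begin

definition padic_abs :: "nat \<Rightarrow> rat \<Rightarrow> real" where
  "padic_abs p q =
    (if q = 0 then 0
     else case quotient_of q of (a, b) \<Rightarrow>
       real p powi (int (multiplicity (int p) b) - int (multiplicity (int p) a)))"

text \<open>
  The sets below live in an ambient field with a complete metric. They are meaningful when that
  field is the field of \<open>p\<close>-adic complex numbers (locale \<open>padic_complex_field\<close>).
  As the metric restricts to the \<open>p\<close>-adic metric on the rationals and the ambient space is
  complete, the closure of the rationals is their \<open>p\<close>-adic completion.
\<close>

definition Qp :: "'a::{field_char_0, metric_space} set" where
  "Qp = closure \<rat>"

definition Zp :: "'a::{field_char_0, metric_space} set" where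
  "Zp = {x \<in> Qp. dist x 0 \<le> 1}"

definition Qp_bar :: "'a::{field_char_0, metric_space} set" where
  "Qp_bar = {x. \<exists>f :: 'a poly. f \<noteq> 0 \<and> (\<forall>i. coeff f i \<in> Qp) \<and> poly f x = 0}"

text \<open>
  The ambient type, with absolute value \<open>absv\<close>, is the completion of an algebraic closure of
  the completion of the rationals for the \<open>p\<close>-adic absolute value. These conditions determine
  it up to isometric field isomorphism. Completeness is the sort constraint
  \<open>complete_space\<close>. The last two axioms say that the elements algebraic over \<open>Qp\<close> form
  an algebraically closed field, i.e. an algebraic closure of \<open>Qp\<close>, and are dense.
\<close>

locale padic_complex_field =
  fixes p :: nat
    and absv :: "'a::{field_char_0, complete_space} \<Rightarrow> real"
  assumes prime_p: "prime p"
    and dist_absv: "dist x y = absv (x - y)"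
    and absv_mult: "absv (x * y) = absv x * absv y"
    and absv_ultrametric: "absv (x + y) \<le> max (absv x) (absv y)"
    and absv_of_rat: "absv (of_rat q) = padic_abs p q"
    and Qp_bar_alg_closed:
      "degree (f :: 'a poly) > 0 \<Longrightarrow> (\<forall>i. coeff f i \<in> Qp_bar) \<Longrightarrow> \<exists>x \<in> Qp_bar. poly f x = 0"
    and Qp_bar_dense: "closure (Qp_bar :: 'a set) = UNIV"

text \<open>
  A function on \<open>Zp\<close> is represented by its extension by \<open>0\<close> to the ambient type, so that
  equality of representatives is equality on \<open>Zp\<close> and the vector space operations are
  the pointwise ones.
\<close>

definition fun_scale :: "'a::field \<Rightarrow> ('a \<Rightarrow> 'a) \<Rightarrow> ('a \<Rightarrow> 'a)" where
  "fun_scale c f = (\<lambda>x. c * f x)"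

lemma vector_space_fun_scale: "vector_space fun_scale"
  by unfold_locales (auto simp: fun_scale_def fun_eq_iff algebra_simps)

definition C_Zp :: "('a::{field_char_0, metric_space} \<Rightarrow> 'a) set" where
  "C_Zp = {f. continuous_on Zp f \<and> (\<forall>x. x \<notin> Zp \<longrightarrow> f x = 0)}"

definition locally_analytic :: "('a::{field_char_0, metric_space} \<Rightarrow> 'a) \<Rightarrow> bool" where
  "locally_analytic f \<longleftrightarrow>
    (\<forall>x0 \<in> Zp. \<exists>r > 0. \<exists>a :: nat \<Rightarrow> 'a.
      \<forall>x \<in> Zp \<inter> ball x0 r. (\<lambda>n. a n * (x - x0) ^ n) sums f x)"

definition la_Zp :: "('a::{field_char_0, metric_space} \<Rightarrow> 'a) set" where
  "la_Zp = {f \<in> C_Zp. locally_analytic f}"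

definition S_op :: "('a::{field_char_0, metric_space} \<Rightarrow> 'a) \<Rightarrow> ('a \<Rightarrow> 'a)" where
  "S_op \<phi> = (\<lambda>x. if x \<in> Zp then \<phi> x - x * \<phi> (x - 1) else 0)"

text \<open>The first conjunct makes \<open>V\<close> a vector space under the pointwise operations.\<close>

definition vs_automorphism_on ::
    "('a::field \<Rightarrow> 'a) set \<Rightarrow> (('a \<Rightarrow> 'a) \<Rightarrow> ('a \<Rightarrow> 'a)) \<Rightarrow> bool" where
  "vs_automorphism_on V T \<longleftrightarrow>
    module.subspace fun_scale V \<and>
    (\<forall>f \<in> V. \<forall>g \<in> V. T (f + g) = T f + T g) \<and>
    (\<forall>c. \<forall>f \<in> V. T (fun_scale c f) = fun_scale c (T f)) \<and>
    bij_betw T V V"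

end

theory Submission
  imports Defs "HOL-Number_Theory.Cong"
begin

text \<open>
  Evaluating \<open>\<phi> x - x * \<phi> (x - 1) = f x\<close> at the natural numbers determines \<open>\<phi>\<close> recursively,
  starting from \<open>\<phi> 0 = f 0\<close>, because the factor \<open>x\<close> vanishes at \<open>0\<close>. As the natural numbers are
  dense in \<open>Zp\<close>, the operator is injective already on continuous functions (\<open>S_op_inj\<close>). Unfolding
  the recursion suggests the inverse
  \<open>\<phi> x = (\<Sum>k. x * (x - 1) * ... * (x - k + 1) * f (x - k))\<close>,
  and as soon as this series converges on \<open>Zp\<close>, a shift of the summation index shows that it solves
  the equation (\<open>S_op_surj\<close>).

  The point is that \<open>\<phi>\<close> is locally analytic when \<open>f\<close> is. Pointwise convergence does not give this;
  the summands must be small as power series. The right measure is the Gauss norm, the supremum of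
  \<open>|a n| * r ^ n\<close> over the coefficients at a centre \<open>c\<close>, and two facts bound it.

  \<^item> Since \<open>Zp\<close> is compact, there are one radius \<open>r\<close> and one bound \<open>M\<close> such that around every
    point of \<open>Zp\<close> the function \<open>f\<close> has an expansion of Gauss norm at most \<open>M\<close>
    (\<open>locally_analytic_uniform\<close>). Hence all translates \<open>f (x - k)\<close> satisfy the same bound
    on the same disc around \<open>c\<close>.

  \<^item> On a disc around \<open>c\<close> of radius \<open>r \<le> 1/p\<close>, each factor \<open>x - i\<close> has Gauss norm
    \<open>max |c - i| r \<le> 1\<close>, and among any \<open>p\<close> consecutive values of \<open>i\<close> one is congruent to \<open>c\<close> modulo
    \<open>p\<close> and has norm at most \<open>1/p\<close>. So the falling factorials tend to \<open>0\<close> in the Gauss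
    norm (\<open>falling_factorial_norm_tendsto_0\<close>).

  A series of functions whose Gauss norms tend to \<open>0\<close> may be rearranged into one power series
  (\<open>bdd_analytic_suminf\<close>), by the interchange of summations for ultrametric double series
  (\<open>sums_swap\<close>).
\<close>

context padic_complex_field
begin

section \<open>The absolute value and its topology\<close>

lemma p_gt_1: "p > 1"
  using prime_p prime_gt_1_nat by blast

lemma absv_0 [simp]: "absv 0 = 0"
  using absv_of_rat[of 0] by (simp add: padic_abs_def)

lemma absv_1 [simp]: "absv 1 = 1"
  using absv_of_rat[of 1] by (simp add: padic_abs_def)

lemma absv_nonneg [simp]: "absv x \<ge> 0"
  using dist_absv[of x 0] zero_le_dist[of x 0] by simp

lemma absv_minus_commute: "absv (x - y) = absv (y - x)"
  using dist_absv[of x y] dist_absv[of y x] by (simp add: dist_commute)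

lemma absv_minus [simp]: "absv (- x) = absv x"
  using absv_minus_commute[of 0 x] by simp

lemma absv_diff_ultrametric: "absv (x - y) \<le> max (absv x) (absv y)"
  using absv_ultrametric[of x "- y"] by simp

lemma absv_add_le: "absv x \<le> e \<Longrightarrow> absv y \<le> e \<Longrightarrow> absv (x + y) \<le> e"
  using absv_ultrametric[of x y] by simp

lemma absv_diff_le: "absv x \<le> e \<Longrightarrow> absv y \<le> e \<Longrightarrow> absv (x - y) \<le> e"
  using absv_diff_ultrametric[of x y] by simp

lemma absv_triangle: "absv (x + y) \<le> absv x + absv y"
  using absv_ultrametric[of x y] absv_nonneg[of x] absv_nonneg[of y] by linarith

lemma absv_power [simp]: "absv (x ^ n) = absv x ^ n"
  by (induction n) (auto simp: absv_mult)

lemma absv_sum_le: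
  assumes "\<And>i. i \<in> A \<Longrightarrow> absv (f i) \<le> e" "e \<ge> 0"
  shows "absv (sum f A) \<le> e"
  using assms by (induction A rule: infinite_finite_induct) (auto intro: absv_add_le)

lemma mem_ball_absv: "x \<in> ball c r \<longleftrightarrow> absv (x - c) < r"
  by (simp add: dist_absv absv_minus_commute)

text \<open>
  Only the absolute value relates the metric to the field operations. Their continuity is therefore
  derived by comparison with real functions that tend to \<open>0\<close>.
\<close>

lemma tendsto_iff_absv: "(f \<longlongrightarrow> l) F \<longleftrightarrow> ((\<lambda>x. absv (f x - l)) \<longlongrightarrow> 0) F"
  by (subst tendsto_dist_iff) (simp add: dist_absv)

lemma tendsto_zero_le:
  fixes f u :: "'b \<Rightarrow> real"
  assumes "(u \<longlongrightarrow> 0) F" "\<And>x. 0 \<le> f x" "\<And>x. f x \<le> u x"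
  shows "(f \<longlongrightarrow> 0) F"
  by (rule Lim_null_comparison[OF _ assms(1)]) (simp add: assms)

lemma tendsto_add_absv:
  fixes f g :: "'b \<Rightarrow> 'a"
  assumes "(f \<longlongrightarrow> a) F" "(g \<longlongrightarrow> b) F"
  shows "((\<lambda>x. f x + g x) \<longlongrightarrow> a + b) F"
proof -
  have u: "((\<lambda>x. absv (f x - a) + absv (g x - b)) \<longlongrightarrow> 0) F"
    using assms unfolding tendsto_iff_absv by (rule tendsto_add_zero)
  have "absv (f x + g x - (a + b)) \<le> absv (f x - a) + absv (g x - b)" for x
    using absv_triangle[of "f x - a" "g x - b"] by (simp add: algebra_simps)
  then show ?thesis
    unfolding tendsto_iff_absv by - (rule tendsto_zero_le[OF u], auto)
qed

lemma tendsto_mult_absv: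
  fixes f g :: "'b \<Rightarrow> 'a"
  assumes "(f \<longlongrightarrow> a) F" "(g \<longlongrightarrow> b) F"
  shows "((\<lambda>x. f x * g x) \<longlongrightarrow> a * b) F"
proof -
  let ?B = "\<lambda>x. absv (f x - a) * absv (g x - b) + (absv a * absv (g x - b) + absv (f x - a) * absv b)"
  have "(?B \<longlongrightarrow> 0 * 0 + (absv a * 0 + 0 * absv b)) F"
    using assms unfolding tendsto_iff_absv by (intro tendsto_intros)
  then have u: "(?B \<longlongrightarrow> 0) F" by simp
  have "absv (f x * g x - a * b) \<le> ?B x" for x
  proof -
    have "f x * g x - a * b = (f x - a) * (g x - b) + (a * (g x - b) + (f x - a) * b)"
      by (simp add: algebra_simps)
    then have "absv (f x * g x - a * b) \<le>
        absv ((f x - a) * (g x - b)) + absv (a * (g x - b) + (f x - a) * b)"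
      using absv_triangle by metis
    also have "\<dots> \<le> ?B x"
      using absv_triangle[of "a * (g x - b)" "(f x - a) * b"] by (simp add: absv_mult)
    finally show ?thesis .
  qed
  then show ?thesis
    unfolding tendsto_iff_absv by - (rule tendsto_zero_le[OF u], auto)
qed

lemma tendsto_diff_absv:
  fixes f g :: "'b \<Rightarrow> 'a"
  assumes "(f \<longlongrightarrow> a) F" "(g \<longlongrightarrow> b) F"
  shows "((\<lambda>x. f x - g x) \<longlongrightarrow> a - b) F"
proof -
  have "((\<lambda>x. f x + (-1) * g x) \<longlongrightarrow> a + (-1) * b) F"
    by (rule tendsto_add_absv[OF assms(1) tendsto_mult_absv[OF tendsto_const assms(2)]])
  then show ?thesis by simp
qed

section \<open>Series over a complete ultrametric field\<close>

lemma sums_add_absv: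
  fixes f g :: "nat \<Rightarrow> 'a"
  assumes "f sums a" "g sums b"
  shows "(\<lambda>n. f n + g n) sums (a + b)"
  using assms unfolding sums_def sum.distrib by (rule tendsto_add_absv)

lemma sums_mult_absv:
  fixes f :: "nat \<Rightarrow> 'a"
  assumes "f sums a"
  shows "(\<lambda>n. c * f n) sums (c * a)"
  using assms unfolding sums_def sum_distrib_left[symmetric]
  by (rule tendsto_mult_absv[OF tendsto_const])

text \<open>
  By the ultrametric inequality a block of terms is no larger than its largest term, and this
  survives the limit. So a remainder is controlled by its terms, without any summability of norms.
\<close>

lemma sums_tail_bound:
  fixes f :: "nat \<Rightarrow> 'a"
  assumes "f sums s" "\<And>k. k \<ge> N \<Longrightarrow> absv (f k) \<le> e" "e \<ge> 0"
  shows "absv (s - sum f {..<N}) \<le> e"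
proof -
  have "(\<lambda>n. absv (s - sum f {..<n})) \<longlonglongrightarrow> 0"
    using assms(1) unfolding sums_def tendsto_iff_absv by (simp add: absv_minus_commute)
  have "absv (s - sum f {..<N}) \<le> e + d" if "d > 0" for d
  proof -
    from \<open>_ \<longlonglongrightarrow> 0\<close> \<open>d > 0\<close> have "\<forall>\<^sub>F n in sequentially. absv (s - sum f {..<n}) < d"
      by (rule order_tendstoD)
    then obtain n where n: "n \<ge> N" "absv (s - sum f {..<n}) < d"
      using nat_le_linear unfolding eventually_sequentially by blast
    have "sum f {..<n} = sum f {..<N} + sum f {N..<n}"
      using sum.atLeastLessThan_concat[of 0 N n f] n(1) by (simp add: lessThan_atLeast0)
    moreover have "absv (sum f {N..<n}) \<le> e"
      using assms by (intro absv_sum_le) auto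
    ultimately show ?thesis
      using n(2) absv_triangle[of "s - sum f {..<n}" "sum f {N..<n}"] by (simp add: algebra_simps)
  qed
  then show ?thesis by (rule field_le_epsilon)
qed

lemma sums_bound:
  fixes f :: "nat \<Rightarrow> 'a"
  assumes "f sums s" "\<And>k. absv (f k) \<le> e" "e \<ge> 0"
  shows "absv s \<le> e"
  using sums_tail_bound[of f s 0 e] assms by simp

lemma summable_absvI:
  fixes f :: "nat \<Rightarrow> 'a"
  assumes "(\<lambda>k. absv (f k)) \<longlonglongrightarrow> 0"
  shows "summable f"
proof -
  have "Cauchy (\<lambda>n. sum f {..<n})"
  proof (rule metric_CauchyI)
    fix e :: real
    assume "e > 0"
    then have "\<forall>\<^sub>F k in sequentially. absv (f k) < e / 2"
      using assms by (intro order_tendstoD) auto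
    then obtain N where N: "\<And>k. k \<ge> N \<Longrightarrow> absv (f k) < e / 2"
      by (auto simp: eventually_sequentially)
    have *: "dist (sum f {..<n}) (sum f {..<m}) < e" if "N \<le> m" "m \<le> n" for m n
    proof -
      have "sum f {..<n} - sum f {..<m} = sum f {m..<n}"
        using sum.atLeastLessThan_concat[of 0 m n f] that(2)
        by (simp add: lessThan_atLeast0 algebra_simps)
      moreover have "absv (sum f {m..<n}) \<le> e / 2"
        using N that \<open>e > 0\<close> by (intro absv_sum_le) (auto intro: less_imp_le)
      ultimately show ?thesis using \<open>e > 0\<close> by (simp add: dist_absv)
    qed
    show "\<exists>N. \<forall>m\<ge>N. \<forall>n\<ge>N. dist (sum f {..<m}) (sum f {..<n}) < e"
    proof (intro exI[of _ N] allI impI)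
      fix m n
      assume "m \<ge> N" "n \<ge> N"
      then show "dist (sum f {..<m}) (sum f {..<n}) < e"
        using *[of m n] *[of n m] nat_le_linear[of m n] by (auto simp: dist_commute)
    qed
  qed
  then show ?thesis
    by (simp add: summable_iff_convergent Cauchy_convergent)
qed

text \<open>
  The hypothesis says that all but finitely many entries \<open>t k n\<close> are at most \<open>e\<close>. Then for large \<open>m\<close>
  both the partial sum of the column sums and the total of the row sums differ from the square
  partial sum over \<open>k, n < m\<close> by at most \<open>e\<close>.
\<close>

lemma sums_swap:
  fixes t :: "nat \<Rightarrow> nat \<Rightarrow> 'a"
  assumes rows: "\<And>k. t k sums R k" and R: "R sums S"
    and cols: "\<And>n. (\<lambda>k. t k n) sums C n"
    and small: "\<And>e. e > 0 \<Longrightarrow> \<exists>N. \<forall>k n. k \<ge> N \<or> n \<ge> N \<longrightarrow> absv (t k n) \<le> e"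
  shows "C sums S"
  unfolding sums_def
proof (rule metric_LIMSEQ_I)
  fix e :: real
  assume "e > 0"
  then obtain N where N: "\<And>k n. k \<ge> N \<or> n \<ge> N \<Longrightarrow> absv (t k n) \<le> e / 2"
    using small[of "e / 2"] by auto
  have e: "e / 2 \<ge> 0" using \<open>e > 0\<close> by simp
  have "dist (sum C {..<m}) S < e" if "m \<ge> N" for m
  proof -
    \<comment> \<open>Errors do not add up: each of the three comparisons below may use the same bound.\<close>
    let ?P = "\<Sum>k<m. \<Sum>n<m. t k n"
    have "absv (R k) \<le> e / 2" if "k \<ge> m" for k
      using N that \<open>m \<ge> N\<close> by (intro sums_bound[OF rows] e) auto
    then have 1: "absv (S - sum R {..<m}) \<le> e / 2"
      by (intro sums_tail_bound R e)
    have "absv (\<Sum>k<m. R k - (\<Sum>n<m. t k n)) \<le> e / 2"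
      using N \<open>m \<ge> N\<close> by (intro absv_sum_le sums_tail_bound rows e) auto
    then have 2: "absv (sum R {..<m} - ?P) \<le> e / 2"
      by (simp add: sum_subtractf)
    have "absv (\<Sum>n<m. C n - (\<Sum>k<m. t k n)) \<le> e / 2"
      using N \<open>m \<ge> N\<close> by (intro absv_sum_le sums_tail_bound[OF cols] e) auto
    moreover have "(\<Sum>n<m. \<Sum>k<m. t k n) = ?P"
      by (rule sum.swap)
    ultimately have 3: "absv (sum C {..<m} - ?P) \<le> e / 2"
      by (simp add: sum_subtractf)
    have "absv ((sum C {..<m} - ?P) - ((S - sum R {..<m}) + (sum R {..<m} - ?P))) \<le> e / 2"
      by (intro absv_diff_le[OF 3] absv_add_le[OF 1 2])
    then have "absv (sum C {..<m} - S) \<le> e / 2"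
      by simp
    then show ?thesis using \<open>e > 0\<close> by (simp add: dist_absv)
  qed
  then show "\<exists>N. \<forall>m\<ge>N. dist (sum C {..<m}) S < e" by blast
qed

section \<open>The ring of p-adic integers\<close>

lemma absv_of_int: "n \<noteq> 0 \<Longrightarrow> absv (of_int n) = real p powi (- int (multiplicity (int p) n))"
  using absv_of_rat[of "of_int n"] by (simp add: padic_abs_def)

lemma absv_of_int_le_1: "absv (of_int n) \<le> 1"
proof (cases "n = 0")
  case False
  then show ?thesis
    using p_gt_1 by (simp add: absv_of_int power_int_minus inverse_le_1_iff one_le_power)
qed auto

lemma absv_of_nat_le_1: "absv (of_nat n) \<le> 1"
  using absv_of_int_le_1[of "int n"] by simp

lemma absv_p: "absv (of_nat p) = 1 / real p"
proof -
  have "multiplicity (int p) (int p) = 1"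
    using prime_p by (intro multiplicity_prime) simp
  then show ?thesis
    using absv_of_int[of "int p"] p_gt_1 by (simp add: power_int_minus field_simps)
qed

lemma absv_dvd_le:
  assumes "int p ^ h dvd n"
  shows "absv (of_int n) \<le> (1 / real p) ^ h"
proof -
  obtain m where "n = int p ^ h * m" using assms by auto
  then have "absv (of_int n) = (1 / real p) ^ h * absv (of_int m)"
    by (simp add: absv_mult absv_p)
  then show ?thesis using absv_of_int_le_1[of m] by (simp add: mult_left_le)
qed

lemma absv_of_int_coprime:
  assumes "\<not> int p dvd n"
  shows "absv (of_int n) = 1"
proof -
  have "n \<noteq> 0" "multiplicity (int p) n = 0"
    using assms by (auto simp: not_dvd_imp_multiplicity_0)
  then show ?thesis by (simp add: absv_of_int)
qed

lemma small_p_power: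
  assumes "e > 0"
  obtains h where "(1 / real p) ^ h < e"
  using real_arch_pow_inv[of e "1 / real p"] p_gt_1 assms by auto

text \<open>
  Write \<open>q = a / b\<close> in lowest terms. The bound on \<open>q\<close> forces \<open>p\<close> not to divide \<open>b\<close>, so \<open>b\<close> is
  invertible modulo \<open>p ^ h\<close>, and \<open>a\<close> times an inverse of \<open>b\<close> is the required integer.
\<close>

lemma rat_integral_approx:
  assumes "absv (of_rat q) \<le> 1"
  shows "\<exists>n::int. absv (of_rat q - of_int n) \<le> (1 / real p) ^ h"
proof (cases "q = 0")
  case True
  then show ?thesis by (intro exI[of _ 0]) simp
next
  case False
  obtain a b where ab: "quotient_of q = (a, b)" by fastforce
  then have b: "b > 0" "coprime a b" and q: "q = of_int a / of_int b"
    by (auto simp: quotient_of_denom_pos quotient_of_coprime quotient_of_div)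
  have "\<not> int p dvd b"
  proof
    assume dvd: "int p dvd b"
    have "\<not> int p dvd a"
    proof
      assume "int p dvd a"
      with b(2) have "is_unit (int p)" using dvd by (rule coprime_common_divisor)
      then show False using p_gt_1 by simp
    qed
    then have "multiplicity (int p) a = 0"
      by (rule not_dvd_imp_multiplicity_0)
    moreover have "multiplicity (int p) b > 0"
      using dvd b(1) prime_p by (simp add: prime_multiplicity_gt_zero_iff)
    ultimately have "padic_abs p q = real p ^ multiplicity (int p) b"
      "real p ^ multiplicity (int p) b > 1"
      using False ab p_gt_1 by (auto simp: padic_abs_def intro: one_less_power)
    then show False using assms absv_of_rat[of q] by simp
  qed
  then have b1: "absv (of_int b) = 1" by (rule absv_of_int_coprime)
  have "coprime b (int p ^ h)"
    using prime_imp_coprime[of "int p" b] \<open>\<not> int p dvd b\<close> prime_p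
    by (simp add: coprime_commute)
  then obtain m where "[b * m = 1] (mod int p ^ h)"
    using cong_solve_coprime_int by blast
  then have "[b * (m * a) = a] (mod int p ^ h)"
    using cong_scalar_right[of "b * m" 1 "int p ^ h" a] by (simp add: mult.assoc)
  then have "int p ^ h dvd b * (m * a) - a"
    by (simp add: cong_iff_dvd_diff)
  then have "absv (of_int (b * (m * a) - a)) \<le> (1 / real p) ^ h"
    by (rule absv_dvd_le)
  moreover have "of_int (b * (m * a) - a) = of_int b * (of_int (m * a) - of_rat q :: 'a)"
    using b(1) by (simp add: q of_rat_divide field_simps)
  ultimately have "absv (of_int (m * a) - of_rat q) \<le> (1 / real p) ^ h"
    by (simp only: absv_mult b1 mult_1)
  then show ?thesis
    unfolding absv_minus_commute[of "of_rat q"] by blast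
qed

lemma Zp_int_approx:
  assumes "x \<in> Zp"
  shows "\<exists>n::int. absv (x - of_int n) \<le> (1 / real p) ^ h"
proof -
  have x: "x \<in> closure \<rat>" "absv x \<le> 1"
    using assms by (auto simp: Zp_def Qp_def dist_absv)
  let ?e = "(1 / real p) ^ h"
  have "?e > 0" "?e \<le> 1" using p_gt_1 by (auto simp: power_le_one)
  then obtain y where "y \<in> \<rat>" "dist y x < ?e"
    using x(1) closure_approachable by blast
  then obtain q where q: "absv (of_rat q - x) < ?e"
    by (auto simp: dist_absv elim!: Rats_cases)
  have "absv (of_rat q - x + x) \<le> 1"
    using q \<open>?e \<le> 1\<close> x(2) by (intro absv_add_le) auto
  then obtain n :: int where "absv (of_rat q - of_int n) \<le> ?e"
    using rat_integral_approx by fastforce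
  then have "absv ((of_rat q - of_int n) - (of_rat q - x)) \<le> ?e"
    by (rule absv_diff_le[OF _ less_imp_le[OF q]])
  then show ?thesis by auto
qed

text \<open>
  The bound \<open>n < p ^ h\<close> matters twice: it makes \<open>Zp\<close> totally bounded, and for \<open>h = 1\<close> it finds a
  residue of \<open>x\<close> among \<open>0, ..., p - 1\<close>.
\<close>

lemma Zp_nat_approx:
  assumes "x \<in> Zp"
  shows "\<exists>n < p ^ h. absv (x - of_nat n) \<le> (1 / real p) ^ h"
proof -
  obtain m :: int where m: "absv (x - of_int m) \<le> (1 / real p) ^ h"
    using Zp_int_approx[OF assms] by blast
  define n where "n = nat (m mod int p ^ h)"
  have pos: "int p ^ h > 0" using p_gt_1 by simp
  then have n: "int n = m mod int p ^ h" by (simp add: n_def)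
  have "absv (of_int (m - int n)) \<le> (1 / real p) ^ h"
    by (rule absv_dvd_le) (simp add: n minus_mod_eq_mult_div)
  then have "absv ((x - of_int m) + of_int (m - int n)) \<le> (1 / real p) ^ h"
    using m by (rule absv_add_le[rotated])
  moreover have "n < p ^ h"
  proof -
    have "int n < int (p ^ h)" using n pos_mod_bound[OF pos, of m] by simp
    then show ?thesis by (simp only: of_nat_less_iff)
  qed
  ultimately show ?thesis by auto
qed

text \<open>
  With \<open>Zp_int_approx\<close>, this identifies \<open>Zp\<close> with the closure of the integers, which makes its
  stability under translation by integers evident.
\<close>

lemma mem_ZpI:
  assumes "\<And>e. e > 0 \<Longrightarrow> \<exists>n::int. absv (x - of_int n) < e"
  shows "x \<in> Zp"
proof -
  have "x \<in> closure \<rat>"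
    unfolding closure_approachable
  proof (intro allI impI)
    fix e :: real
    assume "e > 0"
    then obtain n :: int where "absv (x - of_int n) < e" using assms by blast
    then show "\<exists>y\<in>\<rat>. dist y x < e"
      by (intro bexI[of _ "of_int n"]) (auto simp: dist_absv absv_minus_commute)
  qed
  moreover obtain n :: int where "absv (x - of_int n) < 1" using assms[of 1] by auto
  then have "absv ((x - of_int n) + of_int n) \<le> 1"
    using absv_of_int_le_1 by (intro absv_add_le) auto
  ultimately show ?thesis by (simp add: Zp_def Qp_def dist_absv)
qed

lemma of_nat_in_Zp: "(of_nat n :: 'a) \<in> Zp"
proof (rule mem_ZpI)
  fix e :: real
  assume "e > 0"
  then show "\<exists>m::int. absv (of_nat n - of_int m) < e"
    by (intro exI[of _ "int n"]) simp
qed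

lemma Zp_diff_of_nat:
  assumes "(x :: 'a) \<in> Zp"
  shows "x - of_nat k \<in> Zp"
proof (rule mem_ZpI)
  fix e :: real
  assume "e > 0"
  then obtain h where h: "(1 / real p) ^ h < e" by (rule small_p_power)
  obtain n :: int where "absv (x - of_int n) \<le> (1 / real p) ^ h"
    using Zp_int_approx[OF assms] by blast
  then have "absv ((x - of_nat k) - of_int (n - int k)) < e"
    using h by simp
  then show "\<exists>n::int. absv ((x - of_nat k) - of_int n) < e" by blast
qed

lemma Zp_diff_1: "(x :: 'a) \<in> Zp \<Longrightarrow> x - 1 \<in> Zp"
  using Zp_diff_of_nat[of x 1] by simp

lemma absv_Zp_le_1: "x \<in> Zp \<Longrightarrow> absv x \<le> 1"
  by (simp add: Zp_def dist_absv)

lemma compact_Zp: "compact (Zp :: 'a set)"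
  unfolding compact_eq_totally_bounded
proof (intro conjI allI impI)
  have eq: "(Zp :: 'a set) = closure \<rat> \<inter> cball 0 1"
    by (auto simp: Zp_def Qp_def dist_commute)
  have "closed (Zp :: 'a set)"
    unfolding eq by (intro closed_Int closed_closure closed_cball)
  then show "complete (Zp :: 'a set)"
    by (simp add: complete_eq_closed)
  fix e :: real
  assume "e > 0"
  then obtain h where h: "(1 / real p) ^ h < e" by (rule small_p_power)
  have "(Zp :: 'a set) \<subseteq> (\<Union>c\<in>of_nat ` {..<p ^ h}. ball c e)"
  proof
    fix x :: 'a
    assume "x \<in> Zp"
    then obtain n where "n < p ^ h" "absv (x - of_nat n) \<le> (1 / real p) ^ h"
      using Zp_nat_approx by blast
    then show "x \<in> (\<Union>c\<in>of_nat ` {..<p ^ h}. ball c e)"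
      using h by (intro UN_I[of "of_nat n"]) (simp_all add: mem_ball_absv del: mem_ball)
  qed
  then show "\<exists>K. finite K \<and> (Zp :: 'a set) \<subseteq> (\<Union>c\<in>K. ball c e)"
    by blast
qed

section \<open>Power series with a bounded Gauss norm\<close>

text \<open>
  The function \<open>g\<close> has an expansion around \<open>c\<close> whose Gauss norm for the radius \<open>r\<close> is at most \<open>M\<close>. The
  expansion is required on the open disc only, where the bound on the coefficients already forces the
  terms to decay geometrically.
\<close>

definition bdd_analytic :: "'a \<Rightarrow> real \<Rightarrow> real \<Rightarrow> ('a \<Rightarrow> 'a) \<Rightarrow> bool" where
  "bdd_analytic c r M g \<longleftrightarrow> (\<exists>a. (\<forall>n. absv (a n) * r ^ n \<le> M) \<and>
     (\<forall>x \<in> Zp. absv (x - c) < r \<longrightarrow> (\<lambda>n. a n * (x - c) ^ n) sums g x))"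

lemma bdd_analyticI:
  assumes "\<And>n. absv (a n) * r ^ n \<le> M"
    and "\<And>x. x \<in> Zp \<Longrightarrow> absv (x - c) < r \<Longrightarrow> (\<lambda>n. a n * (x - c) ^ n) sums g x"
  shows "bdd_analytic c r M g"
  using assms unfolding bdd_analytic_def by blast

lemma bdd_analyticE:
  assumes "bdd_analytic c r M g"
  obtains a where "\<And>n. absv (a n) * r ^ n \<le> M"
    and "\<And>x. x \<in> Zp \<Longrightarrow> absv (x - c) < r \<Longrightarrow> (\<lambda>n. a n * (x - c) ^ n) sums g x"
  using assms unfolding bdd_analytic_def by blast

lemma bdd_analytic_mono:
  assumes "bdd_analytic c r M g" "0 \<le> s" "s \<le> r" "M \<le> M'"
  shows "bdd_analytic c s M' g"
proof -
  obtain a where a: "\<And>n. absv (a n) * r ^ n \<le> M"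
    "\<And>x. x \<in> Zp \<Longrightarrow> absv (x - c) < r \<Longrightarrow> (\<lambda>n. a n * (x - c) ^ n) sums g x"
    using bdd_analyticE[OF assms(1)] by metis
  have "absv (a n) * s ^ n \<le> M'" for n
  proof -
    have "absv (a n) * s ^ n \<le> absv (a n) * r ^ n"
      using assms by (intro mult_left_mono power_mono) auto
    then show ?thesis using a(1)[of n] assms(4) by linarith
  qed
  then show ?thesis
    using a(2) assms(3) by (intro bdd_analyticI[of a]) auto
qed

lemma bdd_analytic_cong:
  assumes "bdd_analytic c r M g" "\<And>x. x \<in> Zp \<Longrightarrow> absv (x - c) < r \<Longrightarrow> g x = g' x"
  shows "bdd_analytic c r M g'"
  using assms(1)
proof (rule bdd_analyticE)
  fix a
  assume "\<And>n. absv (a n) * r ^ n \<le> M"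
    and "\<And>x. x \<in> Zp \<Longrightarrow> absv (x - c) < r \<Longrightarrow> (\<lambda>n. a n * (x - c) ^ n) sums g x"
  then show ?thesis
    using assms(2) by (intro bdd_analyticI[of a]) simp_all
qed

lemma bdd_analytic_nonneg:
  assumes "bdd_analytic c r M g"
  shows "M \<ge> 0"
proof -
  obtain a where "\<And>n. absv (a n) * r ^ n \<le> M"
    using assms unfolding bdd_analytic_def by blast
  from this[of 0] have "absv (a 0) \<le> M" by simp
  then show ?thesis using absv_nonneg order_trans by blast
qed

lemma bdd_analytic_term_le:
  assumes "absv (a n) * r ^ n \<le> M" "r > 0"
  shows "absv (a n * y ^ n) \<le> M * (absv y / r) ^ n"
proof -
  have "absv (a n * y ^ n) = (absv (a n) * r ^ n) * (absv y / r) ^ n"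
    using assms(2) by (simp add: absv_mult power_divide)
  also have "\<dots> \<le> M * (absv y / r) ^ n"
    using assms by (intro mult_right_mono) auto
  finally show ?thesis .
qed

lemma bdd_analytic_bound:
  assumes "bdd_analytic c r M g" "r > 0" "x \<in> Zp" "absv (x - c) < r"
  shows "absv (g x) \<le> M"
proof -
  obtain a where a: "\<And>n. absv (a n) * r ^ n \<le> M" "(\<lambda>n. a n * (x - c) ^ n) sums g x"
    using bdd_analyticE[OF assms(1)] assms(3,4) by metis
  have M: "M \<ge> 0" using assms(1) by (rule bdd_analytic_nonneg)
  have "absv (a n * (x - c) ^ n) \<le> M" for n
  proof -
    have "(absv (x - c) / r) ^ n \<le> 1"
      using assms by (intro power_le_one) auto
    then have "M * (absv (x - c) / r) ^ n \<le> M"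
      using M by (rule mult_left_le)
    then show ?thesis
      using bdd_analytic_term_le[of a n r M "x - c", OF a(1) assms(2)] by linarith
  qed
  from a(2) this M show ?thesis by (rule sums_bound)
qed

text \<open>
  All terms of positive degree carry a factor \<open>x - c\<close>, and the value at \<open>c\<close> is the constant
  coefficient.
\<close>

lemma bdd_analytic_lipschitz:
  assumes "bdd_analytic c r M g" "r > 0" "c \<in> Zp" "x \<in> Zp" "absv (x - c) < r"
  shows "absv (g x - g c) \<le> M / r * absv (x - c)"
proof -
  obtain a where a: "\<And>n. absv (a n) * r ^ n \<le> M"
    "\<And>x. x \<in> Zp \<Longrightarrow> absv (x - c) < r \<Longrightarrow> (\<lambda>n. a n * (x - c) ^ n) sums g x"
    using bdd_analyticE[OF assms(1)] by metis
  have M: "M \<ge> 0" using assms(1) by (rule bdd_analytic_nonneg)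
  have "(\<lambda>n. a n * 0 ^ n) sums g c" using a(2)[of c] assms by simp
  moreover have "(\<lambda>n. a n * 0 ^ n) sums (\<Sum>n\<in>{0}. a n * 0 ^ n)"
    by (rule sums_finite) auto
  ultimately have gc: "g c = a 0" by (simp add: sums_unique2)
  have "absv (a n * (x - c) ^ n) \<le> M / r * absv (x - c)" if "n \<ge> 1" for n
  proof -
    have "(absv (x - c) / r) ^ n \<le> (absv (x - c) / r) ^ 1"
      using assms that by (intro power_decreasing) auto
    then have "M * (absv (x - c) / r) ^ n \<le> M * (absv (x - c) / r)"
      using M by (intro mult_left_mono) auto
    then show ?thesis
      using bdd_analytic_term_le[of a n r M "x - c", OF a(1) assms(2)] by simp
  qed
  then have "absv (g x - (\<Sum>n<1. a n * (x - c) ^ n)) \<le> M / r * absv (x - c)"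
    using a(2)[of x] assms M by (intro sums_tail_bound) auto
  then show ?thesis by (simp add: gc)
qed

lemma bdd_analytic_add:
  assumes "bdd_analytic c r M g" "bdd_analytic c r M h" "r > 0"
  shows "bdd_analytic c r M (\<lambda>x. g x + h x)"
proof -
  obtain a where a: "\<And>n. absv (a n) * r ^ n \<le> M"
    "\<And>x. x \<in> Zp \<Longrightarrow> absv (x - c) < r \<Longrightarrow> (\<lambda>n. a n * (x - c) ^ n) sums g x"
    using bdd_analyticE[OF assms(1)] by metis
  obtain b where b: "\<And>n. absv (b n) * r ^ n \<le> M"
    "\<And>x. x \<in> Zp \<Longrightarrow> absv (x - c) < r \<Longrightarrow> (\<lambda>n. b n * (x - c) ^ n) sums h x"
    using bdd_analyticE[OF assms(2)] by metis
  have "absv (a n + b n) * r ^ n \<le> M" for n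
    using absv_add_le[of "a n" "M / r ^ n" "b n"] a(1)[of n] b(1)[of n] assms(3)
    by (simp add: pos_le_divide_eq)
  moreover have "(\<lambda>n. (a n + b n) * (x - c) ^ n) sums (g x + h x)" if "x \<in> Zp" "absv (x - c) < r" for x
    using sums_add_absv[OF a(2)[OF that] b(2)[OF that]] by (simp add: distrib_right)
  ultimately show ?thesis
    by (rule bdd_analyticI)
qed

lemma bdd_analytic_scale:
  assumes "bdd_analytic c r M g"
  shows "bdd_analytic c r (absv k * M) (\<lambda>x. k * g x)"
proof -
  obtain a where a: "\<And>n. absv (a n) * r ^ n \<le> M"
    "\<And>x. x \<in> Zp \<Longrightarrow> absv (x - c) < r \<Longrightarrow> (\<lambda>n. a n * (x - c) ^ n) sums g x"
    using bdd_analyticE[OF assms(1)] by metis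
  have "absv (k * a n) * r ^ n \<le> absv k * M" for n
    using mult_left_mono[OF a(1)[of n], of "absv k"] by (simp add: absv_mult mult_ac)
  moreover have "(\<lambda>n. (k * a n) * (x - c) ^ n) sums (k * g x)" if "x \<in> Zp" "absv (x - c) < r" for x
    using sums_mult_absv[OF a(2)[OF that], of k] by (simp add: mult_ac)
  ultimately show ?thesis
    by (rule bdd_analyticI)
qed

lemma bdd_analytic_const: 
  assumes "r > 0"
  shows "bdd_analytic c r (absv k) (\<lambda>x. k)"
proof -
  have "(\<lambda>n. (if n = 0 then k else 0) * (x - c) ^ n) sums k" for x
    using sums_finite[of "{0}" "\<lambda>n. (if n = 0 then k else 0) * (x - c) ^ n"] by simp
  then show ?thesis
    by (intro bdd_analyticI[of "\<lambda>n. if n = 0 then k else 0"]) auto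
qed

lemma bdd_analytic_shift:
  assumes "bdd_analytic (c - of_nat k) r M g"
  shows "bdd_analytic c r M (\<lambda>x. g (x - of_nat k))"
proof -
  obtain a where a: "\<And>n. absv (a n) * r ^ n \<le> M"
    "\<And>x. x \<in> Zp \<Longrightarrow> absv (x - (c - of_nat k)) < r \<Longrightarrow>
       (\<lambda>n. a n * (x - (c - of_nat k)) ^ n) sums g x"
    using bdd_analyticE[OF assms(1)] by metis
  have "(\<lambda>n. a n * (x - c) ^ n) sums g (x - of_nat k)" if "x \<in> Zp" "absv (x - c) < r" for x
    using a(2)[of "x - of_nat k"] that Zp_diff_of_nat[of x k] by (simp add: algebra_simps)
  with a(1) show ?thesis
    by (rule bdd_analyticI)
qed

text \<open>
  In terms of \<open>y = x - c\<close> the new factor is \<open>(c - d) + y\<close>, a polynomial of Gauss norm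
  \<open>max |c - d| r\<close>. Products with linear factors suffice to treat both powers of \<open>x - d\<close> and falling
  factorials, so general Cauchy products are avoided.
\<close>

lemma bdd_analytic_mult_linear:
  assumes "bdd_analytic c r M g" "r > 0"
  shows "bdd_analytic c r (max (absv (c - d)) r * M) (\<lambda>x. (x - d) * g x)"
proof -
  let ?m = "max (absv (c - d)) r"
  obtain a where a: "\<And>n. absv (a n) * r ^ n \<le> M"
    "\<And>x. x \<in> Zp \<Longrightarrow> absv (x - c) < r \<Longrightarrow> (\<lambda>n. a n * (x - c) ^ n) sums g x"
    using bdd_analyticE[OF assms(1)] by metis
  \<comment> \<open>The coefficients of the product with \<open>(c - d) + y\<close>.\<close>
  define b where "b n = (c - d) * a n + (case n of 0 \<Rightarrow> 0 | Suc m \<Rightarrow> a m)" for n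
  have M: "M \<ge> 0" using assms(1) by (rule bdd_analytic_nonneg)
  have 1: "absv ((c - d) * a n) * r ^ n \<le> ?m * M" for n
    using mult_mono[of "absv (c - d)" ?m "absv (a n) * r ^ n" M] a(1)[of n] assms(2)
    by (simp add: absv_mult mult_ac)
  have 2: "absv (case n of 0 \<Rightarrow> 0 | Suc m \<Rightarrow> a m) * r ^ n \<le> ?m * M" for n
  proof (cases n)
    case 0
    then show ?thesis using assms(2) M by (simp add: le_max_iff_disj)
  next
    case (Suc m)
    then show ?thesis
      using mult_mono[of r ?m "absv (a m) * r ^ m" M] a(1)[of m] assms(2)
      by (simp add: mult_ac)
  qed
  have "absv (b n) * r ^ n \<le> ?m * M" for n
    using absv_add_le[of "(c - d) * a n" "?m * M / r ^ n" "case n of 0 \<Rightarrow> 0 | Suc m \<Rightarrow> a m"]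
      1[of n] 2[of n] assms(2)
    by (simp add: b_def pos_le_divide_eq)
  moreover have "(\<lambda>n. b n * (x - c) ^ n) sums ((x - d) * g x)" if x: "x \<in> Zp" "absv (x - c) < r" for x
  proof -
    define s where "s m = (\<Sum>n<m. a n * (x - c) ^ n)" for m
    have s: "s \<longlonglongrightarrow> g x" using a(2)[OF x] by (simp add: sums_def s_def[abs_def])
    have "(\<Sum>n<Suc m. b n * (x - c) ^ n) = (c - d) * s (Suc m) + (x - c) * s m" for m
      by (induction m) (auto simp: b_def s_def algebra_simps)
    moreover have "(\<lambda>m. (c - d) * s (Suc m) + (x - c) * s m) \<longlonglongrightarrow> (c - d) * g x + (x - c) * g x"
      by (intro tendsto_add_absv tendsto_mult_absv tendsto_const s LIMSEQ_Suc)
    moreover have "(c - d) * g x + (x - c) * g x = (x - d) * g x"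
      by (simp add: algebra_simps)
    ultimately have "(\<lambda>m. \<Sum>n<Suc m. b n * (x - c) ^ n) \<longlonglongrightarrow> (x - d) * g x"
      by (simp only:)
    then show ?thesis unfolding sums_def by (rule LIMSEQ_imp_Suc)
  qed
  ultimately show ?thesis
    by (rule bdd_analyticI)
qed

text \<open>
  The coefficient of degree \<open>n\<close> of the sum is the sum over \<open>k\<close> of the coefficients of degree \<open>n\<close>. Both the
  decay of \<open>u\<close> in \<open>k\<close> and the geometric decay in \<open>n\<close> inside the open disc are needed for the
  interchange of summations.
\<close>

lemma bdd_analytic_suminf:
  assumes g: "\<And>k. bdd_analytic c r (u k) (g k)" and "r > 0"
    and u: "u \<longlonglongrightarrow> 0" "\<And>k. u k \<le> B"
  shows "bdd_analytic c r B (\<lambda>x. \<Sum>k. g k x)"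
    and "\<And>x. x \<in> Zp \<Longrightarrow> absv (x - c) < r \<Longrightarrow> summable (\<lambda>k. g k x)"
proof -
  have "\<forall>k. \<exists>a. (\<forall>n. absv (a n) * r ^ n \<le> u k) \<and>
     (\<forall>x \<in> Zp. absv (x - c) < r \<longrightarrow> (\<lambda>n. a n * (x - c) ^ n) sums g k x)"
    using g unfolding bdd_analytic_def by blast
  then obtain a where a: "\<And>k n. absv (a k n) * r ^ n \<le> u k"
    "\<And>k x. x \<in> Zp \<Longrightarrow> absv (x - c) < r \<Longrightarrow> (\<lambda>n. a k n * (x - c) ^ n) sums g k x"
    by metis
  have u0: "u k \<ge> 0" for k using g bdd_analytic_nonneg by blast
  have B: "B \<ge> 0" using u0[of 0] u(2)[of 0] by linarith
  show summ: "summable (\<lambda>k. g k x)" if "x \<in> Zp" "absv (x - c) < r" for x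
    by (rule summable_absvI, rule tendsto_zero_le[OF u(1)])
      (use bdd_analytic_bound[OF g \<open>r > 0\<close> that] in auto)
  define b where "b n = (\<Sum>k. a k n)" for n
  have b: "(\<lambda>k. a k n) sums b n" for n
  proof -
    have "(\<lambda>k. u k / r ^ n) \<longlonglongrightarrow> 0"
      using tendsto_divide[OF u(1) tendsto_const, of "r ^ n"] \<open>r > 0\<close> by simp
    moreover have "absv (a k n) \<le> u k / r ^ n" for k
      using a(1)[of k n] \<open>r > 0\<close> by (simp add: field_simps)
    ultimately have "(\<lambda>k. absv (a k n)) \<longlonglongrightarrow> 0"
      by - (rule tendsto_zero_le[of "\<lambda>k. u k / r ^ n"], auto)
    then show ?thesis
      unfolding b_def by (intro summable_sums summable_absvI)
  qed
  have "absv (a k n) \<le> B / r ^ n" for k n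
    using a(1)[of k n] u(2)[of k] \<open>r > 0\<close> by (simp add: pos_le_divide_eq)
  then have "absv (b n) \<le> B / r ^ n" for n
    using b B \<open>r > 0\<close> by (intro sums_bound[OF b]) auto
  then have "absv (b n) * r ^ n \<le> B" for n
    using \<open>r > 0\<close> by (simp add: pos_le_divide_eq)
  moreover have "(\<lambda>n. b n * (x - c) ^ n) sums (\<Sum>k. g k x)" if "x \<in> Zp" "absv (x - c) < r" for x
  proof (rule sums_swap[of "\<lambda>k n. a k n * (x - c) ^ n"])
    note x = that
    show "(\<lambda>n. a k n * (x - c) ^ n) sums g k x" for k
      using a(2) x by blast
    show "(\<lambda>k. g k x) sums (\<Sum>k. g k x)"
      using summ[OF x] by (rule summable_sums)
    show "(\<lambda>k. a k n * (x - c) ^ n) sums (b n * (x - c) ^ n)" for n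
      using sums_mult_absv[OF b, of "(x - c) ^ n" n] by (simp add: mult.commute)
    fix e :: real
    assume "e > 0"
    let ?q = "absv (x - c) / r"
    have q: "?q \<ge> 0" "?q < 1" using x \<open>r > 0\<close> by auto
    have term_le: "absv (a k n * (x - c) ^ n) \<le> u k * ?q ^ n" for k n
      by (intro bdd_analytic_term_le a(1) \<open>r > 0\<close>)
    have "(\<lambda>n. B * ?q ^ n) \<longlonglongrightarrow> B * 0"
      using q by (intro tendsto_intros LIMSEQ_realpow_zero) auto
    then have "\<forall>\<^sub>F n in sequentially. B * ?q ^ n < e"
      using \<open>e > 0\<close> by (intro order_tendstoD) auto
    moreover have "\<forall>\<^sub>F k in sequentially. u k < e"
      using u(1) \<open>e > 0\<close> by (rule order_tendstoD)
    ultimately have "\<forall>\<^sub>F n in sequentially. B * ?q ^ n < e \<and> u n < e"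
      by (rule eventually_conj)
    then obtain N where N: "\<And>n. n \<ge> N \<Longrightarrow> B * ?q ^ n < e" "\<And>n. n \<ge> N \<Longrightarrow> u n < e"
      unfolding eventually_sequentially by blast
    have "absv (a k n * (x - c) ^ n) \<le> e" if "k \<ge> N \<or> n \<ge> N" for k n
    proof -
      have "u k * ?q ^ n \<le> B * ?q ^ n"
        using u(2) q by (intro mult_right_mono) auto
      moreover have "u k * ?q ^ n \<le> u k"
        using u0 q by (intro mult_left_le power_le_one) auto
      ultimately show ?thesis
        using term_le[of k n] N(1)[of n] N(2)[of k] that by linarith
    qed
    then show "\<exists>N. \<forall>k n. k \<ge> N \<or> n \<ge> N \<longrightarrow> absv (a k n * (x - c) ^ n) \<le> e"
      by blast
  qed
  ultimately show "bdd_analytic c r B (\<lambda>x. \<Sum>k. g k x)"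
    by (rule bdd_analyticI)
qed

text \<open>
  In an ultrametric space every point of a disc is a centre. Each monomial \<open>a n * (x - c) ^ n\<close> has an
  expansion around \<open>d\<close> of Gauss norm at most \<open>|a n| * s ^ n\<close>, which tends to \<open>0\<close> because \<open>s < r\<close>; summing
  these expansions gives one for \<open>g\<close>.
\<close>

lemma bdd_analytic_recentre:
  assumes g: "bdd_analytic c r M g" and s: "0 < s" "s < r" and d: "absv (d - c) \<le> s"
  shows "bdd_analytic d s M g"
proof -
  obtain a where a: "\<And>n. absv (a n) * r ^ n \<le> M"
    "\<And>x. x \<in> Zp \<Longrightarrow> absv (x - c) < r \<Longrightarrow> (\<lambda>n. a n * (x - c) ^ n) sums g x"
    using bdd_analyticE[OF g] by metis
  have M: "M \<ge> 0" using g by (rule bdd_analytic_nonneg)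
  have terms: "bdd_analytic d s (absv (a n) * s ^ n) (\<lambda>x. a n * (x - c) ^ n)" for n
  proof -
    have "bdd_analytic d s (s ^ n) (\<lambda>x. (x - c) ^ n)"
    proof (induction n)
      case 0
      then show ?case using bdd_analytic_const[OF s(1), of d 1] by simp
    next
      case (Suc n)
      then show ?case
        using bdd_analytic_mult_linear[OF Suc s(1), of c] d by (simp add: max_absorb2)
    qed
    then show ?thesis by (rule bdd_analytic_scale)
  qed
  have le: "absv (a n) * s ^ n \<le> M * (s / r) ^ n" for n
  proof -
    have "absv (a n) * s ^ n = (absv (a n) * r ^ n) * (s / r) ^ n"
      using s by (simp add: power_divide)
    also have "\<dots> \<le> M * (s / r) ^ n"
      using a(1) s by (intro mult_right_mono) auto
    finally show ?thesis .
  qed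
  have "(\<lambda>n. M * (s / r) ^ n) \<longlonglongrightarrow> M * 0"
    using s by (intro tendsto_intros LIMSEQ_realpow_zero) auto
  then have lim: "(\<lambda>n. absv (a n) * s ^ n) \<longlonglongrightarrow> 0"
    using le s by - (rule tendsto_zero_le[of "\<lambda>n. M * (s / r) ^ n"], auto)
  have "absv (a n) * s ^ n \<le> M" for n
  proof -
    have "absv (a n) * s ^ n \<le> absv (a n) * r ^ n"
      using s by (intro mult_left_mono power_mono) auto
    then show ?thesis using a(1)[of n] by linarith
  qed
  with terms s(1) lim have "bdd_analytic d s M (\<lambda>x. \<Sum>n. a n * (x - c) ^ n)"
    by (rule bdd_analytic_suminf(1))
  then show ?thesis
  proof (rule bdd_analytic_cong)
    fix x
    assume x: "x \<in> Zp" "absv (x - d) < s"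
    have "absv ((x - d) + (d - c)) \<le> s"
      using x d by (intro absv_add_le) auto
    then have "absv (x - c) < r" using s by simp
    then show "(\<Sum>n. a n * (x - c) ^ n) = g x"
      using a(2) x(1) by (metis sums_unique)
  qed
qed

section \<open>Locally analytic functions\<close>

lemma locally_analytic_absv:
  fixes f :: "'a \<Rightarrow> 'a"
  shows "locally_analytic f \<longleftrightarrow> (\<forall>c\<in>Zp. \<exists>r>0. \<exists>a. \<forall>x\<in>Zp. absv (x - c) < r \<longrightarrow>
    (\<lambda>n. a n * (x - c) ^ n) sums f x)"
  by (simp only: locally_analytic_def Ball_def Int_iff mem_ball_absv imp_conjL)

text \<open>
  Convergence on a ball bounds the coefficients on any smaller disc whose radius is the absolute
  value of an element of \<open>Zp\<close>, here \<open>p ^ h\<close>: the terms at a point at that distance tend to \<open>0\<close>.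
\<close>

lemma locally_analytic_iff:
  fixes f :: "'a \<Rightarrow> 'a"
  shows "locally_analytic f \<longleftrightarrow> (\<forall>c\<in>Zp. \<exists>r>0. \<exists>M. bdd_analytic c r M f)"
proof
  assume f: "locally_analytic f"
  show "\<forall>c\<in>Zp. \<exists>r>0. \<exists>M. bdd_analytic c r M f"
  proof
    fix c :: 'a
    assume c: "c \<in> Zp"
    obtain r a where "r > 0"
      and a: "\<And>x. x \<in> Zp \<Longrightarrow> absv (x - c) < r \<Longrightarrow> (\<lambda>n. a n * (x - c) ^ n) sums f x"
      using f c unfolding locally_analytic_absv by meson
    obtain h where h: "(1 / real p) ^ h < r" using \<open>r > 0\<close> by (rule small_p_power)
    let ?s = "(1 / real p) ^ h"
    have s: "?s > 0" using p_gt_1 by simp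
    define y :: 'a where "y = c - of_nat (p ^ h)"
    have "y \<in> Zp" unfolding y_def using c by (rule Zp_diff_of_nat)
    moreover have "absv (y - c) = ?s" by (simp add: y_def absv_p)
    ultimately have y: "y \<in> Zp" "absv (y - c) = ?s" .
    let ?t = "\<lambda>n. a n * (y - c) ^ n"
    have "(\<lambda>m. sum ?t {..<m}) \<longlonglongrightarrow> f y"
      using a[of y] y h by (simp add: sums_def)
    then have "(\<lambda>m. sum ?t {..<Suc m} - sum ?t {..<m}) \<longlonglongrightarrow> f y - f y"
      by (intro tendsto_diff_absv[OF LIMSEQ_Suc])
    then have "?t \<longlonglongrightarrow> 0" by simp
    then have "(\<lambda>n. absv (?t n)) \<longlonglongrightarrow> 0" by (simp add: tendsto_iff_absv)
    then have "Bseq (\<lambda>n. absv (?t n))" by (rule convergent_imp_Bseq[OF convergentI])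
    then obtain M where "\<forall>n. norm (absv (?t n)) \<le> M" by (rule BseqE)
    then have "\<And>n. absv (a n) * ?s ^ n \<le> M" using y(2) by (simp add: absv_mult)
    then have "bdd_analytic c ?s M f"
      by (rule bdd_analyticI) (use a h in auto)
    then show "\<exists>r>0. \<exists>M. bdd_analytic c r M f" using s by blast
  qed
next
  assume "\<forall>c\<in>Zp. \<exists>r>0. \<exists>M. bdd_analytic c r M f"
  then show "locally_analytic f"
    unfolding locally_analytic_absv bdd_analytic_def by meson
qed

text \<open>
  Recentring gives, for each \<open>c\<close>, a radius and a bound valid around all nearby centres. Finitely many
  such neighbourhoods cover the compact set \<open>Zp\<close>; take the smallest radius and the largest bound.
\<close>

lemma locally_analytic_uniform:
  assumes "locally_analytic f"
  obtains r M where "r > 0" "\<And>c. c \<in> Zp \<Longrightarrow> bdd_analytic c r M f"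
proof -
  have "\<forall>c\<in>Zp. \<exists>s>0. \<exists>M. \<forall>d. absv (d - c) < s \<longrightarrow> bdd_analytic d s M f"
  proof
    fix c :: 'a
    assume "c \<in> Zp"
    then obtain r M where "r > 0" "bdd_analytic c r M f"
      using assms unfolding locally_analytic_iff by blast
    then have "\<forall>d. absv (d - c) < r / 2 \<longrightarrow> bdd_analytic d (r / 2) M f"
      by (auto intro: bdd_analytic_recentre[of c r])
    then show "\<exists>s>0. \<exists>M. \<forall>d. absv (d - c) < s \<longrightarrow> bdd_analytic d s M f"
      using \<open>r > 0\<close> half_gt_zero by blast
  qed
  then obtain s M where s: "\<And>c. c \<in> Zp \<Longrightarrow> s c > 0"
    and M: "\<And>c d. c \<in> Zp \<Longrightarrow> absv (d - c) < s c \<Longrightarrow> bdd_analytic d (s c) (M c) f"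
    by metis
  have "(Zp :: 'a set) \<subseteq> (\<Union>c\<in>Zp. ball c (s c))" using s by force
  then obtain K where K: "K \<subseteq> Zp" "finite K" "(Zp :: 'a set) \<subseteq> (\<Union>c\<in>K. ball c (s c))"
    using compactE_image[OF compact_Zp, of Zp "\<lambda>c. ball c (s c)"] by blast
  \<comment> \<open>The inserted elements only ensure that the sets are nonempty.\<close>
  define r where "r = Min (insert 1 (s ` K))"
  define B where "B = Max (insert 0 (M ` K))"
  have "r > 0" using K s by (auto simp: r_def)
  moreover have "bdd_analytic d r B f" if "d \<in> Zp" for d
  proof -
    have "d \<in> (\<Union>c\<in>K. ball c (s c))" using K(3) that by blast
    then obtain c where "c \<in> K" "d \<in> ball c (s c)" by blast
    then have c: "c \<in> K" "absv (d - c) < s c" by (simp_all only: mem_ball_absv)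
    have "r \<le> s c" "M c \<le> B" using K(2) c(1) by (auto simp: r_def B_def)
    then show ?thesis
      using M[of c d] c K(1) \<open>r > 0\<close> by - (rule bdd_analytic_mono[of d "s c" "M c"], auto)
  qed
  ultimately show thesis by (rule that)
qed

lemma locally_analytic_imp_continuous_on:
  fixes f :: "'a \<Rightarrow> 'a"
  assumes "locally_analytic f"
  shows "continuous_on Zp f"
  unfolding continuous_on_def
proof
  fix c :: 'a
  assume c: "c \<in> Zp"
  then obtain r M where r: "r > 0" "bdd_analytic c r M f"
    using assms unfolding locally_analytic_iff by blast
  have id: "((\<lambda>x. absv (x - c)) \<longlongrightarrow> 0) (at c within Zp)"
    using tendsto_ident_at[of c Zp] unfolding tendsto_iff_absv .
  have "\<forall>\<^sub>F x in at c within Zp. x \<in> Zp"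
    by (simp add: eventually_at_filter)
  moreover have "\<forall>\<^sub>F x in at c within Zp. absv (x - c) < r"
    using id r(1) by (rule order_tendstoD)
  ultimately have "\<forall>\<^sub>F x in at c within Zp. absv (f x - f c) \<le> M / r * absv (x - c)"
    by eventually_elim (rule bdd_analytic_lipschitz[OF r(2,1) c])
  moreover have "((\<lambda>x. M / r * absv (x - c)) \<longlongrightarrow> M / r * 0) (at c within Zp)"
    using id by (intro tendsto_intros)
  ultimately show "(f \<longlongrightarrow> f c) (at c within Zp)"
    unfolding tendsto_iff_absv by - (rule Lim_null_comparison[of _ "\<lambda>x. M / r * absv (x - c)"], auto)
qed

lemma la_Zp_iff:
  fixes f :: "'a \<Rightarrow> 'a"
  shows "f \<in> la_Zp \<longleftrightarrow> locally_analytic f \<and> (\<forall>x. x \<notin> Zp \<longrightarrow> f x = 0)"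
  by (auto simp: la_Zp_def C_Zp_def locally_analytic_imp_continuous_on)

lemma locally_analytic_add:
  fixes f g :: "'a \<Rightarrow> 'a"
  assumes "locally_analytic f" "locally_analytic g"
  shows "locally_analytic (\<lambda>x. f x + g x)"
  unfolding locally_analytic_iff
proof
  fix c :: 'a
  assume c: "c \<in> Zp"
  obtain r M where r: "r > 0" "bdd_analytic c r M f"
    using assms(1) c unfolding locally_analytic_iff by blast
  obtain s N where s: "s > 0" "bdd_analytic c s N g"
    using assms(2) c unfolding locally_analytic_iff by blast
  have "bdd_analytic c (min r s) (max M N) f" "bdd_analytic c (min r s) (max M N) g"
    using r s by (auto intro: bdd_analytic_mono)
  then have "bdd_analytic c (min r s) (max M N) (\<lambda>x. f x + g x)"
    using r s by (intro bdd_analytic_add) auto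
  then show "\<exists>r>0. \<exists>M. bdd_analytic c r M (\<lambda>x. f x + g x)"
    using r(1) s(1) by (intro exI[of _ "min r s"]) auto
qed

lemma locally_analytic_scale:
  fixes f :: "'a \<Rightarrow> 'a"
  shows "locally_analytic f \<Longrightarrow> locally_analytic (\<lambda>x. k * f x)"
  unfolding locally_analytic_iff using bdd_analytic_scale by blast

lemma locally_analytic_mult_ident:
  fixes f :: "'a \<Rightarrow> 'a"
  assumes "locally_analytic f"
  shows "locally_analytic (\<lambda>x. x * f x)"
  unfolding locally_analytic_iff
proof
  fix c :: 'a
  assume "c \<in> Zp"
  then obtain r M where r: "r > 0" "bdd_analytic c r M f"
    using assms unfolding locally_analytic_iff by blast
  have "bdd_analytic c r (max (absv (c - 0)) r * M) (\<lambda>x. (x - 0) * f x)"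
    using r(2,1) by (rule bdd_analytic_mult_linear)
  then show "\<exists>r>0. \<exists>M. bdd_analytic c r M (\<lambda>x. x * f x)"
    using r(1) unfolding diff_zero by blast
qed

lemma locally_analytic_shift:
  fixes f :: "'a \<Rightarrow> 'a"
  assumes "locally_analytic f"
  shows "locally_analytic (\<lambda>x. f (x - 1))"
  unfolding locally_analytic_iff
proof
  fix c :: 'a
  assume "c \<in> Zp"
  then obtain r M where "r > 0" "bdd_analytic (c - of_nat 1) r M f"
    using assms Zp_diff_of_nat[of c 1] unfolding locally_analytic_iff by blast
  then show "\<exists>r>0. \<exists>M. bdd_analytic c r M (\<lambda>x. f (x - 1))"
    using bdd_analytic_shift[of c 1 r M f] by auto
qed

lemma locally_analytic_cong:
  fixes f g :: "'a \<Rightarrow> 'a"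
  assumes "locally_analytic f" "\<And>x. x \<in> Zp \<Longrightarrow> f x = g x"
  shows "locally_analytic g"
  unfolding locally_analytic_iff
proof
  fix c :: 'a
  assume "c \<in> Zp"
  then obtain r M where "r > 0" "bdd_analytic c r M f"
    using assms(1) unfolding locally_analytic_iff by blast
  then show "\<exists>r>0. \<exists>M. bdd_analytic c r M g"
    using bdd_analytic_cong[of c r M f g] assms(2) by blast
qed

lemma S_op_preserves_la_Zp:
  assumes "(f :: 'a \<Rightarrow> 'a) \<in> la_Zp"
  shows "S_op f \<in> la_Zp"
proof -
  have f: "locally_analytic f" using assms by (simp add: la_Zp_iff)
  have "locally_analytic (\<lambda>x. f x + (-1) * (x * f (x - 1)))"
    by (intro locally_analytic_add locally_analytic_scale locally_analytic_mult_ident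
        locally_analytic_shift f)
  then have "locally_analytic (S_op f)"
    by (rule locally_analytic_cong) (simp add: S_op_def)
  then show ?thesis by (simp add: la_Zp_iff S_op_def)
qed

lemma subspace_la_Zp: "module.subspace fun_scale (la_Zp :: ('a \<Rightarrow> 'a) set)"
proof -
  interpret vector_space "fun_scale :: 'a \<Rightarrow> ('a \<Rightarrow> 'a) \<Rightarrow> 'a \<Rightarrow> 'a"
    by (rule vector_space_fun_scale)
  show ?thesis
  proof (rule subspaceI)
    have "locally_analytic (\<lambda>x. 0 :: 'a)"
      unfolding locally_analytic_iff
    proof
      fix c :: 'a
      show "\<exists>r>0. \<exists>M. bdd_analytic c r M (\<lambda>x. 0)"
        using bdd_analytic_const[OF zero_less_one, of c 0] zero_less_one by blast
    qed
    then show "0 \<in> (la_Zp :: ('a \<Rightarrow> 'a) set)"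
      by (simp add: la_Zp_iff zero_fun_def)
    show "f + g \<in> la_Zp" if "f \<in> la_Zp" "g \<in> la_Zp" for f g :: "'a \<Rightarrow> 'a"
      using that by (auto simp: la_Zp_iff plus_fun_def intro: locally_analytic_add)
    show "fun_scale c f \<in> la_Zp" if "f \<in> la_Zp" for c and f :: "'a \<Rightarrow> 'a"
      using that by (auto simp: la_Zp_iff fun_scale_def intro: locally_analytic_scale)
  qed
qed

section \<open>The operator and its inverse\<close>

lemma S_op_preserves_C_Zp:
  assumes "(f :: 'a \<Rightarrow> 'a) \<in> C_Zp"
  shows "S_op f \<in> C_Zp"
proof -
  have f: "continuous_on Zp f" using assms by (simp add: C_Zp_def)
  have minus: "continuous_on Zp (\<lambda>x. x - 1 :: 'a)"
    unfolding continuous_on_def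
    by (intro ballI tendsto_diff_absv tendsto_ident_at tendsto_const)
  have "continuous_on Zp (\<lambda>x. f (x - 1))"
    by (rule continuous_on_compose2[OF f minus]) (auto intro: Zp_diff_1)
  then have "continuous_on Zp (\<lambda>x. f x - x * f (x - 1))"
    using f unfolding continuous_on_def
    by (intro ballI tendsto_diff_absv tendsto_mult_absv tendsto_ident_at) simp_all
  then have "continuous_on Zp (S_op f)"
    by (rule continuous_on_eq) (simp add: S_op_def)
  then show ?thesis by (simp add: C_Zp_def S_op_def)
qed

lemma S_op_add:
  fixes f g :: "'a \<Rightarrow> 'a"
  shows "S_op (f + g) = S_op f + S_op g"
  by (auto simp: S_op_def fun_eq_iff algebra_simps)

lemma S_op_scale:
  fixes f :: "'a \<Rightarrow> 'a"
  shows "S_op (fun_scale c f) = fun_scale c (S_op f)"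
  by (auto simp: S_op_def fun_eq_iff fun_scale_def algebra_simps)

text \<open>
  The two functions agree at \<open>0\<close>, since the second term of the operator vanishes there, hence at all
  natural numbers by recursion, hence on \<open>Zp\<close> by density and continuity.
\<close>

lemma S_op_inj:
  assumes f: "(f :: 'a \<Rightarrow> 'a) \<in> C_Zp" and g: "(g :: 'a \<Rightarrow> 'a) \<in> C_Zp" and eq: "S_op f = S_op g"
  shows "f = g"
proof
  fix x
  have nat: "f (of_nat n) = g (of_nat n)" for n
  proof (induction n)
    case 0
    then show ?case using fun_cong[OF eq, of 0] of_nat_in_Zp[of 0] by (simp add: S_op_def)
  next
    case (Suc n)
    then show ?case
      using fun_cong[OF eq, of "of_nat (Suc n)"] of_nat_in_Zp[of "Suc n"] by (simp add: S_op_def)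
  qed
  show "f x = g x"
  proof (cases "x \<in> Zp")
    case True
    have "\<forall>h. \<exists>n. absv (x - of_nat n) \<le> (1 / real p) ^ h"
      using Zp_nat_approx[OF True] by blast
    then obtain a where a: "\<And>h. absv (x - of_nat (a h)) \<le> (1 / real p) ^ h" by metis
    have "(\<lambda>h. (1 / real p) ^ h) \<longlonglongrightarrow> 0"
      using p_gt_1 by (intro LIMSEQ_realpow_zero) auto
    then have "(\<lambda>h. absv (x - of_nat (a h))) \<longlonglongrightarrow> 0"
      using a by - (rule tendsto_zero_le[of "\<lambda>h. (1 / real p) ^ h"], auto)
    then have lim: "(\<lambda>h. of_nat (a h)) \<longlonglongrightarrow> x" by (simp add: tendsto_iff_absv absv_minus_commute[of _ x])
    have cont: "(\<lambda>h. \<phi> (of_nat (a h))) \<longlonglongrightarrow> \<phi> x" if "\<phi> \<in> C_Zp" for \<phi> :: "'a \<Rightarrow> 'a"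
      by (rule continuous_on_tendsto_compose[OF _ lim True])
        (use that in \<open>simp_all add: C_Zp_def of_nat_in_Zp\<close>)
    have "(\<lambda>h. g (of_nat (a h))) \<longlonglongrightarrow> f x"
      using cont[OF f] by (simp only: nat)
    then show ?thesis using cont[OF g] by (rule LIMSEQ_unique)
  next
    case False
    then show ?thesis using f g by (simp add: C_Zp_def)
  qed
qed

text \<open>
  Here \<open>w k\<close> bounds the Gauss norm of the \<open>k\<close>-th falling factorial on the disc of radius \<open>r\<close> around
  \<open>x\<close>. No factor exceeds \<open>1\<close>, and every block of \<open>p\<close> consecutive factors contains one that is at
  most \<open>1/p\<close>.
\<close>

lemma falling_factorial_norm_tendsto_0:
  fixes x :: 'a
  assumes x: "x \<in> Zp" and r: "0 < r" "r \<le> 1 / real p"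
  defines "w \<equiv> \<lambda>k. \<Prod>i<k. max (absv (x - of_nat i)) r"
  shows "w \<longlonglongrightarrow> 0" and "w k \<le> 1"
proof -
  have le1: "max (absv (x - of_nat i)) r \<le> 1" for i
  proof -
    have "1 / real p \<le> 1" using p_gt_1 by simp
    then show ?thesis
      using absv_Zp_le_1[OF Zp_diff_of_nat[OF x]] r by simp
  qed
  have w0: "w k \<ge> 0" for k
    unfolding w_def using r by (intro prod_nonneg) (auto simp: le_max_iff_disj)
  have dec: "decseq w"
    unfolding decseq_Suc_iff using le1 w0 by (auto simp: w_def intro: mult_left_le)
  show "w k \<le> 1"
    using decseqD[OF dec, of 0 k] by (simp add: w_def)
  \<comment> \<open>The small factor in the \<open>j\<close>-th block is the one at position \<open>p * j + m\<close>.\<close>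
  obtain m where m: "m < p" "absv (x - of_nat m) \<le> 1 / real p"
    using Zp_nat_approx[OF x, of 1] by auto
  have step: "w (p * Suc j) \<le> w (p * j) * (1 / real p)" for j
  proof -
    let ?i = "p * j + m"
    have "absv (of_nat (p * j)) \<le> 1 / real p"
      using absv_of_nat_le_1[of j] p_gt_1
      by (simp add: absv_mult absv_p divide_right_mono)
    then have "absv ((x - of_nat m) - of_nat (p * j)) \<le> 1 / real p"
      using m(2) by (rule absv_diff_le[rotated])
    then have "max (absv (x - of_nat ?i)) r \<le> 1 / real p"
      using r by (simp add: algebra_simps)
    then have "w ?i * max (absv (x - of_nat ?i)) r \<le> w ?i * (1 / real p)"
      by (rule mult_left_mono[OF _ w0])
    then have "w (Suc ?i) \<le> w ?i * (1 / real p)"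
      by (simp only: w_def prod.lessThan_Suc)
    moreover have "w (p * Suc j) \<le> w (Suc ?i)" "w ?i \<le> w (p * j)"
      using m(1) by (auto intro: decseqD[OF dec])
    ultimately show ?thesis
      using mult_right_mono[of "w ?i" "w (p * j)" "1 / real p"] by simp
  qed
  have pow: "w (p * j) \<le> (1 / real p) ^ j" for j
  proof (induction j)
    case 0
    then show ?case by (simp add: w_def)
  next
    case (Suc j)
    then have "w (p * j) * (1 / real p) \<le> (1 / real p) ^ j * (1 / real p)"
      by (intro mult_right_mono) auto
    then show ?case using step[of j] by simp
  qed
  show "w \<longlonglongrightarrow> 0"
  proof (rule LIMSEQ_I)
    fix e :: real
    assume "e > 0"
    then obtain j where j: "(1 / real p) ^ j < e" by (rule small_p_power)
    have "w k < e" if "k \<ge> p * j" for k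
      using decseqD[OF dec that] pow[of j] j by linarith
    then show "\<exists>N. \<forall>k\<ge>N. norm (w k - 0) < e" using w0 by auto
  qed
qed

text \<open>
  On a disc that does not depend on \<open>k\<close>, the Gauss norm of the \<open>k\<close>-th summand is at most a uniform bound
  for the translates of \<open>f\<close> times that of the \<open>k\<close>-th falling factorial, so it tends to \<open>0\<close>.
\<close>

lemma falling_factorial_series:
  assumes "locally_analytic (f :: 'a \<Rightarrow> 'a)"
  defines "g \<equiv> \<lambda>k x. (\<Prod>i<k. x - of_nat i) * f (x - of_nat k)"
  shows "locally_analytic (\<lambda>x. \<Sum>k. g k x)" and "\<And>x. x \<in> Zp \<Longrightarrow> summable (\<lambda>k. g k x)"
proof -
  obtain r0 M where r0: "r0 > 0" "\<And>c. c \<in> Zp \<Longrightarrow> bdd_analytic c r0 M f"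
    using locally_analytic_uniform[OF assms(1)] by blast
  define r where "r = min r0 (1 / real p)"
  have r: "0 < r" "r \<le> 1 / real p" using r0 p_gt_1 by (auto simp: r_def)
  have f: "bdd_analytic c r M f" if "c \<in> Zp" for c
    by (rule bdd_analytic_mono[OF r0(2)[OF that]]) (use r in \<open>auto simp: r_def\<close>)
  have *: "bdd_analytic c r M (\<lambda>x. \<Sum>k. g k x) \<and> summable (\<lambda>k. g k c)" if c: "c \<in> Zp" for c
  proof -
    define w where "w k = (\<Prod>i<k. max (absv (c - of_nat i)) r)" for k
    note w = falling_factorial_norm_tendsto_0[OF c r, folded w_def]
    have M: "M \<ge> 0" using f[OF c] by (rule bdd_analytic_nonneg)
    have g: "bdd_analytic c r (w k * M) (g k)" for k
    proof -
      \<comment> \<open>The number of factors varies independently of the translation, to make the induction work.\<close>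
      have "bdd_analytic c r ((\<Prod>i<j. max (absv (c - of_nat i)) r) * M)
          (\<lambda>x. (\<Prod>i<j. x - of_nat i) * f (x - of_nat k))" for j
      proof (induction j)
        case 0
        then show ?case using bdd_analytic_shift[OF f[OF Zp_diff_of_nat[OF c]]] by simp
      next
        case (Suc j)
        then show ?case
          using bdd_analytic_mult_linear[OF Suc r(1), of "of_nat j"] by (simp add: mult_ac)
      qed
      then show ?thesis by (simp add: g_def w_def)
    qed
    have lim: "(\<lambda>k. w k * M) \<longlonglongrightarrow> 0"
      using w(1) by (rule tendsto_mult_left_zero)
    have le: "w k * M \<le> M" for k
      using mult_right_mono[OF w(2)[of k] M] by simp
    show ?thesis
    proof
      show "bdd_analytic c r M (\<lambda>x. \<Sum>k. g k x)"
        by (rule bdd_analytic_suminf(1)[OF g r(1) lim le])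
      show "summable (\<lambda>k. g k c)"
        by (rule bdd_analytic_suminf(2)[OF g r(1) lim le c]) (simp add: r(1))
    qed
  qed
  show "locally_analytic (\<lambda>x. \<Sum>k. g k x)"
    unfolding locally_analytic_iff using * r(1) by blast
  show "\<And>x. x \<in> Zp \<Longrightarrow> summable (\<lambda>k. g k x)" using * by blast
qed

text \<open>
  The series telescopes under the operator: \<open>g (k + 1) x = x * g k (x - 1)\<close>, so subtracting
  \<open>x * \<phi> (x - 1)\<close> from \<open>\<phi> x\<close> leaves only the summand \<open>g 0 x = f x\<close>.
\<close>

lemma S_op_surj:
  assumes f: "(f :: 'a \<Rightarrow> 'a) \<in> la_Zp"
  shows "\<exists>\<phi>\<in>la_Zp. S_op \<phi> = f"
proof -
  define g where "g k x = (\<Prod>i<k. x - of_nat i) * f (x - of_nat k)" for k x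
  have la: "locally_analytic f" using f by (simp add: la_Zp_iff)
  note series = falling_factorial_series[OF la, folded g_def]
  define \<phi> where "\<phi> x = (if x \<in> Zp then \<Sum>k. g k x else 0)" for x
  have "locally_analytic \<phi>"
    by (rule locally_analytic_cong[OF series(1)]) (simp add: \<phi>_def)
  then have "\<phi> \<in> la_Zp" by (simp add: la_Zp_iff \<phi>_def)
  moreover have "S_op \<phi> = f"
  proof
    fix x
    show "S_op \<phi> x = f x"
    proof (cases "x \<in> Zp")
      case x: True
      have Suc: "g (Suc k) x = x * g k (x - 1)" for k
      proof -
        have "(\<Prod>i<Suc k. x - of_nat i) = x * (\<Prod>i<k. x - 1 - of_nat i)"
          by (subst prod.lessThan_Suc_shift) (simp add: algebra_simps)
        then show ?thesis by (simp add: g_def algebra_simps)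
      qed
      have "(\<lambda>k. g k (x - 1)) sums \<phi> (x - 1)"
        using series(2)[OF Zp_diff_1[OF x]] Zp_diff_1[OF x] by (simp add: \<phi>_def summable_sums)
      then have "(\<lambda>k. g (Suc k) x) sums (x * \<phi> (x - 1))"
        unfolding Suc by (rule sums_mult_absv)
      then have "(\<lambda>m. (\<Sum>k<m. g (Suc k) x) + g 0 x) \<longlonglongrightarrow> x * \<phi> (x - 1) + g 0 x"
        unfolding sums_def by (intro tendsto_add_absv tendsto_const)
      then have "(\<lambda>m. \<Sum>k<Suc m. g k x) \<longlonglongrightarrow> x * \<phi> (x - 1) + g 0 x"
        by (simp add: sum.lessThan_Suc_shift add.commute del: sum.lessThan_Suc)
      then have "(\<lambda>k. g k x) sums (x * \<phi> (x - 1) + g 0 x)"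
        unfolding sums_def by (rule LIMSEQ_imp_Suc)
      then have "\<phi> x = x * \<phi> (x - 1) + f x"
        using x by (simp add: \<phi>_def sums_unique[symmetric]) (simp add: g_def)
      then show ?thesis using x by (simp add: S_op_def)
    next
      case False
      then show ?thesis using f by (simp add: S_op_def la_Zp_iff)
    qed
  qed
  ultimately show ?thesis by blast
qed

lemma S_op_bij_betw: "bij_betw S_op (la_Zp :: ('a \<Rightarrow> 'a) set) la_Zp"
  unfolding bij_betw_def
proof
  show "inj_on S_op (la_Zp :: ('a \<Rightarrow> 'a) set)"
    by (rule inj_onI) (auto simp: la_Zp_def intro: S_op_inj)
  show "S_op ` (la_Zp :: ('a \<Rightarrow> 'a) set) = la_Zp"
    using S_op_preserves_la_Zp S_op_surj by blast
qed

end

theorem theorem2p7: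
  fixes p :: nat
    and absv :: "'a::{field_char_0, complete_space} \<Rightarrow> real"
  assumes "prime p"
    and "padic_complex_field p absv"
  shows "S_op ` (C_Zp :: ('a \<Rightarrow> 'a) set) \<subseteq> C_Zp \<and>
         vs_automorphism_on (la_Zp :: ('a \<Rightarrow> 'a) set) S_op"
proof -
  interpret padic_complex_field p absv by fact
  show ?thesis
    unfolding vs_automorphism_on_def
    using S_op_preserves_C_Zp subspace_la_Zp S_op_add S_op_scale S_op_bij_betw by blast
qed

end
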